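(* Let $n,p$ be integers with $p\ge 2$ and $n \geq p+2$, and let $T_1,T_2$ be two tournaments with vertex set $[n]$. There exists a family $X_1, \dots, X_\ell \subseteq [n]$ of subsets each of size exactly $p$ such that $T_2 = \mathrm{Inv}(T_1; X_1, \dots, X_\ell)$ if and only if one of the following occurs: (1) $p \equiv 0 \pmod 4$ and $|F(T_1)| \equiv |F(T_2)| \pmod 2$; (2) $p \equiv 1 \pmod 4$, $|F(T_1,i)| \equiv |F(T_2,i)| \pmod 2$ for every $i \in [n-1]$, and $|F(T_1)| \equiv |F(T_2)| \pmod 2$; (3) $p \equiv 2 \pmod 4$; (4) $p \equiv 3 \pmod 4$ and $|F(T_1,i)| \equiv |F(T_2,i)| \pmod 2$ for every $i \in [n-1]$.
   Context: For an oriented graph $D$ and $X\subseteq V(D)$, the inversion of $X$ reverses the orientation of every arc with both endpoints in $X$; $\mathrm{Inv}(D;X_1,\dots,X_\ell)$ denotes the oriented graph obtained by inverting $X_1,\dots,X_\ell$ one after another (equivalently, reversing exactly the arcs whose two endpoints lie together in an odd number of the $X_j$). For a tournament $T$ on $[n]$, an arc $ij$ is forward if $i<j$; $F(T)$ is the set of forward arcs of $T$, and $F(T,i)$ is the set of forward arcs of $T$ incident with vertex $i$. *)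

theory Defs
  imports "Graph_Theory.Pair_Digraph" "HOL-Number_Theory.Cong"
begin

locale oriented_graph = pair_digraph +
  assumes no_opposite_arcs: "(u, v) \<in> parcs G \<Longrightarrow> (v, u) \<notin> parcs G"

locale tournament = oriented_graph +
  assumes arc_between:
    "\<lbrakk>u \<in> pverts G; v \<in> pverts G; u \<noteq> v\<rbrakk> \<Longrightarrow> (u, v) \<in> parcs G \<or> (v, u) \<in> parcs G"

definition inversion :: "'a pair_pre_digraph \<Rightarrow> 'a set \<Rightarrow> 'a pair_pre_digraph" where
  "inversion D X = D\<lparr>parcs :=
     {(u, v). (u, v) \<in> parcs D \<and> \<not> (u \<in> X \<and> v \<in> X)} \<union>
     {(v, u) | u v. (u, v) \<in> parcs D \<and> u \<in> X \<and> v \<in> X}\<rparr>"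

definition Inv :: "'a pair_pre_digraph \<Rightarrow> 'a set list \<Rightarrow> 'a pair_pre_digraph" where
  "Inv D Xs = foldl inversion D Xs"

definition forward_arcs :: "nat pair_pre_digraph \<Rightarrow> (nat \<times> nat) set" where
  "forward_arcs T = {(i, j). (i, j) \<in> parcs T \<and> i < j}"

definition forward_arcs_at :: "nat pair_pre_digraph \<Rightarrow> nat \<Rightarrow> (nat \<times> nat) set" where
  "forward_arcs_at T i = {e \<in> forward_arcs T. fst e = i \<or> snd e = i}"

lemma pverts_inversion [simp]: "pverts (inversion D X) = pverts D"
  by (simp add: inversion_def)

lemma in_parcs_inversion_iff:
  "(u, v) \<in> parcs (inversion D X) \<longleftrightarrow>
     (if u \<in> X \<and> v \<in> X then (v, u) \<in> parcs D else (u, v) \<in> parcs D)"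
  by (auto simp: inversion_def)

lemma pverts_Inv [simp]: "pverts (Inv D Xs) = pverts D"
  unfolding Inv_def by (induction Xs arbitrary: D) simp_all

lemma in_parcs_Inv_iff:
  "(u, v) \<in> parcs (Inv D Xs) \<longleftrightarrow>
     (if odd (length (filter (\<lambda>X. u \<in> X \<and> v \<in> X) Xs))
      then (v, u) \<in> parcs D else (u, v) \<in> parcs D)"
  unfolding Inv_def
  by (induction Xs arbitrary: D) (auto simp: in_parcs_inversion_iff)

end

theory Submission
  imports Defs "HOL-Library.Ramsey"
begin

text \<open>
  Encode a tournament on \<open>[n]\<close> by the edge set of its forward arcs; inverting \<open>X\<close> adds the
  complete graph \<open>[X]\<^bsup>2\<^esup>\<close> over \<open>\<bbbF>\<^sub>2\<close>. So the question is which graphs lie in the span \<open>S\<close> of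
  the complete graphs on \<open>p\<close> vertices. Sizes and degrees of these graphs give necessity. Conversely,
  exchanging one vertex of a \<open>p\<close>-clique for another shows that \<open>S\<close> contains every \<open>K\<^bsub>{a,b},A\<^esub>\<close>
  with \<open>|A| = p - 1\<close>, and exchanging a vertex of \<open>A\<close> (here \<open>n \<ge> p + 2\<close> is used) gives all
  4-cycles, hence all \<open>K\<^bsub>{a,b},A\<^esub>\<close> with \<open>|A|\<close> even. If \<open>p\<close> is odd, this makes all triangles
  congruent modulo \<open>S\<close>, and triangles span the graphs with even degrees. If \<open>p\<close> is even, it also
  puts the paths with two edges into \<open>S\<close>, so that all edges are congruent. Edges and triangles have
  an odd number of edges, so in both cases a sum of them lies in \<open>S\<close> if it has even size, and a
  graph of odd size can be reduced to this case by adding a \<open>p\<close>-clique when \<open>p choose 2\<close> is odd.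
\<close>

section \<open>Spans under symmetric difference\<close>

definition xor_sum :: "'a set list \<Rightarrow> 'a set" where
  "xor_sum As = foldr sym_diff As {}"

definition xor_span :: "'a set set \<Rightarrow> 'a set set" where
  "xor_span G = xor_sum ` lists G"

definition xor_closed :: "'a set set \<Rightarrow> bool" where
  "xor_closed T \<longleftrightarrow> {} \<in> T \<and> (\<forall>A\<in>T. \<forall>B\<in>T. sym_diff A B \<in> T)"

definition xor_linear :: "('a set \<Rightarrow> 'b set) \<Rightarrow> bool" where
  "xor_linear f \<longleftrightarrow> (\<forall>A B. f (sym_diff A B) = sym_diff (f A) (f B))"

lemma xor_sum_Nil [simp]: "xor_sum [] = {}"
  by (simp add: xor_sum_def)

lemma xor_sum_Cons [simp]: "xor_sum (A # As) = sym_diff A (xor_sum As)"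
  by (simp add: xor_sum_def)

lemma xor_sum_append: "xor_sum (As @ Bs) = sym_diff (xor_sum As) (xor_sum Bs)"
  by (induction As) auto

lemma in_xor_sum_iff: "x \<in> xor_sum As \<longleftrightarrow> odd (length (filter (\<lambda>A. x \<in> A) As))"
  by (induction As) auto

lemma xor_closed_empty: "xor_closed T \<Longrightarrow> {} \<in> T"
  by (simp add: xor_closed_def)

lemma xor_closed_sym_diff: "\<lbrakk>xor_closed T; A \<in> T; B \<in> T\<rbrakk> \<Longrightarrow> sym_diff A B \<in> T"
  by (simp add: xor_closed_def)

lemma xor_closed_sym_diff_trans:
  assumes "xor_closed T" "sym_diff A B \<in> T" "sym_diff B C \<in> T"
  shows "sym_diff A C \<in> T"
proof -
  have "sym_diff (sym_diff A B) (sym_diff B C) \<in> T"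
    using assms by (rule xor_closed_sym_diff)
  also have "sym_diff (sym_diff A B) (sym_diff B C) = sym_diff A C"
    by blast
  finally show ?thesis .
qed

lemma xor_closed_Pow: "xor_closed (Pow A)"
  by (auto simp: xor_closed_def)

lemma xor_closed_xor_sum: "\<lbrakk>xor_closed T; set As \<subseteq> T\<rbrakk> \<Longrightarrow> xor_sum As \<in> T"
  by (induction As) (simp_all add: xor_closed_empty xor_closed_sym_diff)

lemma xor_span_minimal: "\<lbrakk>G \<subseteq> T; xor_closed T\<rbrakk> \<Longrightarrow> xor_span G \<subseteq> T"
  by (auto simp: xor_span_def intro!: xor_closed_xor_sum)

lemma xor_closed_xor_span: "xor_closed (xor_span G)"
  unfolding xor_closed_def
proof (intro conjI ballI)
  show "{} \<in> xor_span G"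
    unfolding xor_span_def by (rule image_eqI[of _ _ "[]"]) simp_all
next
  fix A B assume "A \<in> xor_span G" "B \<in> xor_span G"
  then obtain As Bs where "As \<in> lists G" "A = xor_sum As" "Bs \<in> lists G" "B = xor_sum Bs"
    by (auto simp: xor_span_def)
  then show "sym_diff A B \<in> xor_span G"
    unfolding xor_span_def by (intro image_eqI[of _ _ "As @ Bs"]) (simp_all add: xor_sum_append)
qed

lemma xor_span_base: "A \<in> G \<Longrightarrow> A \<in> xor_span G"
  unfolding xor_span_def by (rule image_eqI[of _ _ "[A]"]) simp_all

lemma xor_linearD: "xor_linear f \<Longrightarrow> f (sym_diff A B) = sym_diff (f A) (f B)"
  by (simp add: xor_linear_def)

lemma xor_linear_empty: "xor_linear f \<Longrightarrow> f {} = {}"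
  using xor_linearD[of f "{}" "{}"] by simp

lemma xor_linear_image: "inj f \<Longrightarrow> xor_linear (image f)"
  by (simp add: xor_linear_def image_Un image_set_diff)

lemma xor_linear_sym_diff:
  assumes "xor_linear f" "xor_linear g"
  shows "xor_linear (\<lambda>A. sym_diff (f A) (g A))"
  unfolding xor_linear_def xor_linearD[OF assms(1)] xor_linearD[OF assms(2)] by blast

lemma xor_closed_vimage: "\<lbrakk>xor_linear f; xor_closed T\<rbrakk> \<Longrightarrow> xor_closed (f -` T)"
  by (simp add: xor_closed_def xor_linearD xor_linear_empty)

lemma xor_closed_image:
  assumes "xor_linear f" "xor_closed T"
  shows "xor_closed (f ` T)"
  unfolding xor_closed_def
proof (intro conjI ballI)
  show "{} \<in> f ` T"
    using xor_closed_empty[OF assms(2)] xor_linear_empty[OF assms(1)] by force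
next
  fix A B assume "A \<in> f ` T" "B \<in> f ` T"
  then obtain A' B' where "A' \<in> T" "A = f A'" "B' \<in> T" "B = f B'" by blast
  then show "sym_diff A B \<in> f ` T"
    by (intro image_eqI[of _ _ "sym_diff A' B'"] xor_closed_sym_diff assms(2))
      (simp_all add: xor_linearD[OF assms(1)])
qed

lemma finite_in_xor_closed:
  assumes "finite A" "xor_closed T" "\<And>x. x \<in> A \<Longrightarrow> {x} \<in> T"
  shows "A \<in> T"
  using assms(1,3)
proof (induction A)
  case empty
  then show ?case using assms(2) by (simp add: xor_closed_empty)
next
  case (insert x A)
  then have "sym_diff {x} A \<in> T"
    by (intro xor_closed_sym_diff assms(2)) simp_all
  also have "sym_diff {x} A = insert x A"
    using insert.hyps by auto
  finally show ?case .
qed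

lemma even_card_sym_diff:
  assumes "finite A" "finite B"
  shows "even (card (sym_diff A B)) \<longleftrightarrow> (even (card A) \<longleftrightarrow> even (card B))"
proof -
  have "card (sym_diff A B) = card (A - B) + card (B - A)"
    using assms by (intro card_Un_disjoint) auto
  moreover have "card A = card (A \<inter> B) + card (A - B)" "card B = card (A \<inter> B) + card (B - A)"
    using card_Int_Diff[OF assms(1), of B] card_Int_Diff[OF assms(2), of A]
    by (simp_all add: Int_commute)
  ultimately show ?thesis by auto
qed

lemma xor_closed_even_card: "xor_closed {A. finite A \<and> even (card A)}"
  by (simp add: xor_closed_def even_card_sym_diff)

lemma even_card_xor_sum:
  assumes "\<forall>A\<in>set As. finite A \<and> odd (card A)"
  shows "finite (xor_sum As) \<and> (even (card (xor_sum As)) \<longleftrightarrow> even (length As))"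
  using assms by (induction As) (auto simp: even_card_sym_diff)

lemma even_card_in_xor_closed:
  assumes T: "xor_closed T"
    and congruent: "\<And>A B. \<lbrakk>A \<in> G; B \<in> G\<rbrakk> \<Longrightarrow> sym_diff A B \<in> T"
    and odd: "\<And>A. A \<in> G \<Longrightarrow> finite A \<and> odd (card A)"
    and E: "E \<in> xor_span G" "even (card E)"
  shows "E \<in> T"
proof -
  obtain As where As: "set As \<subseteq> G" "E = xor_sum As"
    using E(1) by (auto simp: xor_span_def)
  then have "even (length As)"
    using even_card_xor_sum[of As] odd E(2) by auto
  then have "xor_sum As \<in> T"
    using As(1)
  proof (induction As rule: induct_list012)
    case 1
    then show ?case using T by (simp add: xor_closed_empty)
  next
    case (3 A B As)
    then have "sym_diff (sym_diff A B) (xor_sum As) \<in> T"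
      by (intro xor_closed_sym_diff T congruent) simp_all
    also have "sym_diff (sym_diff A B) (xor_sum As) = xor_sum (A # B # As)"
      by auto
    finally show ?case .
  qed simp
  then show ?thesis using As(2) by simp
qed

lemma even_card_subset_in_xor_closed:
  assumes "finite A" "even (card A)" "xor_closed T"
    and congruent: "\<And>x y. \<lbrakk>x \<in> A; y \<in> A\<rbrakk> \<Longrightarrow> sym_diff {x} {y} \<in> T"
  shows "A \<in> T"
proof (rule even_card_in_xor_closed[OF assms(3)])
  show "A \<in> xor_span ((\<lambda>x. {x}) ` A)"
    by (rule finite_in_xor_closed[OF assms(1) xor_closed_xor_span]) (simp add: xor_span_base)
next
  fix B C assume "B \<in> (\<lambda>x. {x}) ` A" "C \<in> (\<lambda>x. {x}) ` A"
  then obtain x y where "x \<in> A" "y \<in> A" "B = {x}" "C = {y}" by blast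
  then show "sym_diff B C \<in> T" by (simp only: congruent)
qed (use assms(2) in auto)

section \<open>Complete graphs and bicliques\<close>

definition star :: "'a \<Rightarrow> 'a set \<Rightarrow> 'a set set" where
  "star a A = (\<lambda>y. {a, y}) ` A"

text \<open>
  This is \<open>K\<^bsub>{a,b},A\<^esub>\<close> if \<open>a \<noteq> b\<close> lie outside \<open>A\<close>. The symmetric difference instead of a union makes
  it additive in \<open>A\<close> without side conditions.
\<close>

definition biclique :: "'a \<Rightarrow> 'a \<Rightarrow> 'a set \<Rightarrow> 'a set set" where
  "biclique a b A = sym_diff (star a A) (star b A)"

lemma xor_linear_star: "xor_linear (star a)"
  unfolding star_def by (intro xor_linear_image) (auto simp: inj_def doubleton_eq_iff)

lemma xor_linear_biclique: "xor_linear (biclique a b)"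
  unfolding biclique_def by (intro xor_linear_sym_diff xor_linear_star)

lemma finite_subset_nsets: "\<lbrakk>finite V; E \<subseteq> [V]\<^bsup>k\<^esup>\<rbrakk> \<Longrightarrow> finite E"
  by (rule finite_subset[OF _ finite_imp_finite_nsets])

lemma insert_in_nsets: "\<lbrakk>A \<in> [V]\<^bsup>k\<^esup>; a \<in> V; a \<notin> A\<rbrakk> \<Longrightarrow> insert a A \<in> [V]\<^bsup>Suc k\<^esup>"
  by (simp add: nsets_def)

lemma nsets_2_insert:
  assumes "a \<notin> A"
  shows "[insert a A]\<^bsup>2\<^esup> = sym_diff ([A]\<^bsup>2\<^esup>) (star a A)"
proof -
  have "[insert a A]\<^bsup>2\<^esup> = [A]\<^bsup>2\<^esup> \<union> star a A"
    using nsets_disjoint_2[of "{a}" A] assms by (auto simp: star_def nsets_singleton_iff)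
  moreover have "[A]\<^bsup>2\<^esup> \<inter> star a A = {}"
    using assms by (auto simp: star_def)
  ultimately show ?thesis by blast
qed

lemma sym_diff_nsets_2_insert:
  assumes "a \<notin> A" "b \<notin> A"
  shows "sym_diff ([insert a A]\<^bsup>2\<^esup>) ([insert b A]\<^bsup>2\<^esup>) = biclique a b A"
  unfolding nsets_2_insert[OF assms(1)] nsets_2_insert[OF assms(2)] biclique_def by blast

lemma nsets_2_of_edge: "e \<in> [V]\<^bsup>2\<^esup> \<Longrightarrow> [e]\<^bsup>2\<^esup> = {e}"
  by (auto elim: nsets2_E)

lemma nsets_Suc_exchange_induct [consumes 2, case_names refl exchange]:
  assumes X: "X \<in> [V]\<^bsup>Suc k\<^esup>" and Y: "Y \<in> [V]\<^bsup>Suc k\<^esup>"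
    and refl: "P Y"
    and exchange: "\<And>x y B. \<lbrakk>x \<in> V; y \<in> V; B \<in> [V - {x, y}]\<^bsup>k\<^esup>; P (insert y B)\<rbrakk>
      \<Longrightarrow> P (insert x B)"
  shows "P X"
  using X
proof (induction "card (X - Y)" arbitrary: X)
  case 0
  then have "X = Y"
    using Y by (auto simp: nsets_def card_subset_eq)
  then show ?case using refl by simp
next
  case (Suc m)
  then have "X - Y \<noteq> {}" by force
  then obtain x where x: "x \<in> X" "x \<notin> Y" by auto
  then have "\<not> Y \<subseteq> X"
    using Suc.prems Y card_subset_eq[of X Y] by (auto simp: nsets_def)
  then obtain y where y: "y \<in> Y" "y \<notin> X" by auto
  let ?B = "X - {x}"
  have B: "?B \<in> [V - {x, y}]\<^bsup>k\<^esup>" "insert y ?B \<in> [V]\<^bsup>Suc k\<^esup>" "x \<in> V" "y \<in> V"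
    using Suc.prems Y x y by (auto simp: nsets_def)
  have "insert y ?B - Y = (X - Y) - {x}" using y by auto
  then have "P (insert y ?B)"
    using Suc.hyps(2) x by (intro Suc.hyps(1) B) simp
  then have "P (insert x ?B)"
    using B by (intro exchange[of x y])
  then show ?case using x by (simp add: insert_absorb)
qed

lemma nsets_2_congruent_of_bicliques:
  assumes T: "xor_closed T"
    and biclique: "\<And>a b A. \<lbrakk>a \<in> V; b \<in> V; A \<in> [V - {a, b}]\<^bsup>k\<^esup>\<rbrakk> \<Longrightarrow> biclique a b A \<in> T"
    and "X \<in> [V]\<^bsup>Suc k\<^esup>" "Y \<in> [V]\<^bsup>Suc k\<^esup>"
  shows "sym_diff ([X]\<^bsup>2\<^esup>) ([Y]\<^bsup>2\<^esup>) \<in> T"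
  using assms(3,4)
proof (induction rule: nsets_Suc_exchange_induct)
  case refl
  then show ?case using T by (simp add: xor_closed_empty)
next
  case (exchange x y B)
  then have "x \<notin> B" "y \<notin> B" by (auto simp: nsets_def)
  then have "sym_diff ([insert x B]\<^bsup>2\<^esup>) ([insert y B]\<^bsup>2\<^esup>) \<in> T"
    using biclique[OF exchange(1-3)] by (simp add: sym_diff_nsets_2_insert)
  with T show ?case using exchange.IH by (rule xor_closed_sym_diff_trans)
qed

definition clique_span :: "'a set \<Rightarrow> nat \<Rightarrow> 'a set set set" where
  "clique_span V p = xor_span ((\<lambda>X. [X]\<^bsup>2\<^esup>) ` [V]\<^bsup>p\<^esup>)"

lemma xor_closed_clique_span: "xor_closed (clique_span V p)"
  unfolding clique_span_def by (rule xor_closed_xor_span)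

lemma clique_in_clique_span: "X \<in> [V]\<^bsup>p\<^esup> \<Longrightarrow> [X]\<^bsup>2\<^esup> \<in> clique_span V p"
  unfolding clique_span_def by (intro xor_span_base imageI)

lemma clique_span_subset:
  assumes "E \<in> clique_span V p"
  shows "E \<subseteq> [V]\<^bsup>2\<^esup>"
proof -
  have "[X]\<^bsup>2\<^esup> \<subseteq> [V]\<^bsup>2\<^esup>" if "X \<in> [V]\<^bsup>p\<^esup>" for X
    using that by (intro nsets_mono) (simp add: nsets_def)
  then have "clique_span V p \<subseteq> Pow ([V]\<^bsup>2\<^esup>)"
    unfolding clique_span_def by (intro xor_span_minimal xor_closed_Pow) auto
  then show ?thesis using assms by auto
qed

lemma clique_span_imp_even_card:
  assumes "even (p choose 2)" "E \<in> clique_span V p"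
  shows "even (card E)"
proof -
  have "clique_span V p \<subseteq> {E. finite E \<and> even (card E)}"
    unfolding clique_span_def
    by (rule xor_span_minimal[OF _ xor_closed_even_card])
      (use assms(1) in \<open>auto simp: nsets_def[of V] finite_imp_finite_nsets\<close>)
  then show ?thesis using assms(2) by auto
qed

lemma biclique_in_clique_span:
  assumes "a \<in> V" "b \<in> V" "A \<in> [V - {a, b}]\<^bsup>k\<^esup>"
  shows "biclique a b A \<in> clique_span V (Suc k)"
proof -
  have notin: "a \<notin> A" "b \<notin> A" using assms by (auto simp: nsets_def)
  have "A \<in> [V]\<^bsup>k\<^esup>" using assms(3) nsets_mono[of "V - {a, b}" V k] by blast
  then have "insert a A \<in> [V]\<^bsup>Suc k\<^esup>" "insert b A \<in> [V]\<^bsup>Suc k\<^esup>"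
    by (simp_all add: insert_in_nsets assms notin)
  then have "sym_diff ([insert a A]\<^bsup>2\<^esup>) ([insert b A]\<^bsup>2\<^esup>) \<in> clique_span V (Suc k)"
    by (intro xor_closed_sym_diff xor_closed_clique_span clique_in_clique_span)
  then show ?thesis by (simp add: sym_diff_nsets_2_insert notin)
qed

section \<open>Degrees\<close>

definition degree :: "'a set set \<Rightarrow> 'a \<Rightarrow> nat" where
  "degree E v = card {e \<in> E. v \<in> e}"

definition even_degrees :: "'a set set \<Rightarrow> bool" where
  "even_degrees E \<longleftrightarrow> (\<forall>v. even (degree E v))"

lemma even_degree_sym_diff:
  assumes "finite E" "finite F"
  shows "even (degree (sym_diff E F) v) \<longleftrightarrow> (even (degree E v) \<longleftrightarrow> even (degree F v))"
proof -
  have "{e \<in> sym_diff E F. v \<in> e} = sym_diff {e \<in> E. v \<in> e} {e \<in> F. v \<in> e}" by auto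
  then show ?thesis using assms by (simp add: degree_def even_card_sym_diff)
qed

lemma xor_closed_even_degrees: "xor_closed {E. finite E \<and> even_degrees E}"
  by (auto simp: xor_closed_def even_degrees_def even_degree_sym_diff) (simp add: degree_def)

lemma degree_nsets_2:
  assumes "v \<in> X"
  shows "degree ([X]\<^bsup>2\<^esup>) v = card X - 1"
proof -
  have "{e \<in> [X]\<^bsup>2\<^esup>. v \<in> e} = star v (X - {v})"
    using assms by (auto simp: nsets_2_eq star_def)
  moreover have "inj_on (\<lambda>y. {v, y}) (X - {v})"
    by (auto simp: inj_on_def doubleton_eq_iff)
  ultimately show ?thesis
    using assms by (simp add: degree_def star_def card_image)
qed

lemma degree_eq_0: "\<lbrakk>E \<subseteq> [V]\<^bsup>2\<^esup>; v \<notin> V\<rbrakk> \<Longrightarrow> degree E v = 0"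
  unfolding degree_def by (rule card_eq_0_iff[THEN iffD2]) (auto simp: nsets_def)

lemma even_degrees_nsets_2:
  assumes "odd (card X)"
  shows "even_degrees ([X]\<^bsup>2\<^esup>)"
  unfolding even_degrees_def
proof
  fix v
  show "even (degree ([X]\<^bsup>2\<^esup>) v)"
    using assms by (cases "v \<in> X") (simp_all add: degree_nsets_2 degree_eq_0[of _ X])
qed

lemma handshake:
  assumes "finite V" "E \<subseteq> [V]\<^bsup>2\<^esup>"
  shows "(\<Sum>v\<in>V. degree E v) = 2 * card E"
  unfolding degree_def
proof (rule sum_multicount[OF assms(1)])
  show "finite E"
    using assms by (rule finite_subset_nsets)
  have "{v \<in> V. v \<in> e} = e" "card e = 2" if "e \<in> E" for e
    using that assms(2) by (auto simp: nsets_def)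
  then show "\<forall>e\<in>E. card {v \<in> V. v \<in> e} = 2" by simp
qed

lemma even_degrees_iff_all_but_one:
  assumes "finite V" "E \<subseteq> [V]\<^bsup>2\<^esup>" "v \<in> V"
  shows "even_degrees E \<longleftrightarrow> (\<forall>u\<in>V - {v}. even (degree E u))"
proof
  assume others: "\<forall>u\<in>V - {v}. even (degree E u)"
  have "degree E v + (\<Sum>u\<in>V - {v}. degree E u) = 2 * card E"
    using handshake[OF assms(1,2)] sum.remove[OF assms(1,3)] by metis
  moreover have "even (\<Sum>u\<in>V - {v}. degree E u)"
    using others by (intro dvd_sum) auto
  ultimately have "even (degree E v)"
    by (metis dvd_triv_left even_add)
  then show "even_degrees E"
    unfolding even_degrees_def using others degree_eq_0[OF assms(2)]
    by (metis Diff_iff even_zero singletonD)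
qed (simp add: even_degrees_def)

lemma even_degrees_star_empty:
  assumes E: "E \<subseteq> [V]\<^bsup>2\<^esup>" "even_degrees E" and star: "\<And>e. e \<in> E \<Longrightarrow> v \<in> e"
  shows "E = {}"
proof (rule ccontr)
  assume "E \<noteq> {}"
  then obtain e where e: "e \<in> E" by auto
  have edge: "\<exists>u. u \<noteq> v \<and> f = {v, u}" if "f \<in> E" for f
    using E(1) star[OF that] that by (auto elim!: nsets2_E)
  obtain u where u: "u \<noteq> v" "e = {v, u}" using edge[OF e] by auto
  then have "{f \<in> E. u \<in> f} = {e}" using e edge by auto
  then have "degree E u = 1" by (simp add: degree_def)
  then show False using E(2) unfolding even_degrees_def by (metis odd_one)
qed

lemma clique_span_imp_even_degrees:
  assumes "odd p" "E \<in> clique_span V p"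
  shows "even_degrees E"
proof -
  have "clique_span V p \<subseteq> {E. finite E \<and> even_degrees E}"
    unfolding clique_span_def
    by (rule xor_span_minimal[OF _ xor_closed_even_degrees])
      (use assms(1) in \<open>auto simp: nsets_def[of V] finite_imp_finite_nsets even_degrees_nsets_2\<close>)
  then show ?thesis using assms(2) by auto
qed

lemma ex_triangle_sum_off_vertex:
  assumes "v \<in> V" "finite A" "A \<subseteq> [V - {v}]\<^bsup>2\<^esup>"
  shows "\<exists>F \<in> clique_span V 3. {e \<in> F. v \<notin> e} = A"
proof -
  let ?off = "\<lambda>F. {e \<in> F. v \<notin> e}"
  have "A \<in> ?off ` clique_span V 3"
  proof (rule finite_in_xor_closed[OF assms(2)])
    have "xor_linear ?off" by (auto simp: xor_linear_def)
    then show "xor_closed (?off ` clique_span V 3)"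
      by (intro xor_closed_image xor_closed_clique_span)
  next
    fix e assume "e \<in> A"
    then have e: "e \<in> [V]\<^bsup>2\<^esup>" "v \<notin> e" using assms(3) by (auto simp: nsets_def)
    then have "insert v e \<in> [V]\<^bsup>3\<^esup>" using assms(1) by (auto simp: nsets_def)
    then have "[insert v e]\<^bsup>2\<^esup> \<in> clique_span V 3" by (rule clique_in_clique_span)
    moreover have "{e} = ?off ([insert v e]\<^bsup>2\<^esup>)"
      using e nsets_2_of_edge[OF e(1)] by (auto simp: nsets_2_insert star_def)
    ultimately show "{e} \<in> ?off ` clique_span V 3"
      by (intro image_eqI)
  qed
  then show ?thesis by auto
qed

lemma even_degrees_in_triangle_span:
  assumes "finite V" and E: "E \<subseteq> [V]\<^bsup>2\<^esup>" "even_degrees E"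
  shows "E \<in> clique_span V 3"
proof (cases "E = {}")
  case True
  then show ?thesis by (simp add: xor_closed_empty xor_closed_clique_span)
next
  case False
  then obtain v where v: "v \<in> V" using E(1) by (auto elim!: nsets2_E)
  note fin = finite_subset_nsets[OF assms(1)]
  have "{e \<in> E. v \<notin> e} \<subseteq> [V - {v}]\<^bsup>2\<^esup>" using E(1) by (auto simp: nsets_def)
  then obtain F where F: "F \<in> clique_span V 3" "{e \<in> F. v \<notin> e} = {e \<in> E. v \<notin> e}"
    using ex_triangle_sum_off_vertex[OF v, of "{e \<in> E. v \<notin> e}"] fin[OF E(1)] by auto
  have F': "F \<subseteq> [V]\<^bsup>2\<^esup>" "even_degrees F"
    using F(1) by (simp_all add: clique_span_subset clique_span_imp_even_degrees[of 3])
  then have "sym_diff E F \<subseteq> [V]\<^bsup>2\<^esup>" "even_degrees (sym_diff E F)"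
    using E fin by (auto simp: even_degrees_def even_degree_sym_diff)
  moreover have "v \<in> e" if "e \<in> sym_diff E F" for e
    using that F(2) by blast
  ultimately have "sym_diff E F = {}" by (rule even_degrees_star_empty)
  then have "E = F" by blast
  then show ?thesis using F(1) by simp
qed

section \<open>Membership in the span of the cliques of a given size\<close>

lemma ex_nsets_superset_avoiding:
  assumes "finite V" "finite W" "A \<subseteq> V - W" "card A \<le> k" "k + card W \<le> card V"
  shows "\<exists>B \<in> [V - W]\<^bsup>k\<^esup>. A \<subseteq> B"
proof -
  have "k \<le> card (V - W)"
    using assms(5) diff_card_le_card_Diff[OF assms(2), of V] by linarith
  then obtain B where "A \<subseteq> B" "B \<subseteq> V - W" "card B = k"
    using exists_subset_between[of A k "V - W"] assms by auto
  then show ?thesis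
    using assms(1) by (auto simp: nsets_def dest: finite_subset)
qed

context
  fixes V :: "'a set" and p :: nat
  assumes finite_V: "finite V" and p_ge_2: "p \<ge> 2" and card_V: "card V \<ge> p + 2"
begin

text \<open>Writing \<open>sym_diff {c} {d}\<close> for \<open>{c, d}\<close> covers the degenerate case \<open>c = d\<close>.\<close>

lemma four_cycle_in_clique_span:
  assumes "a \<in> V" "b \<in> V" "c \<in> V - {a, b}" "d \<in> V - {a, b}"
  shows "biclique a b (sym_diff {c} {d}) \<in> clique_span V p"
proof -
  obtain k where k: "p = Suc (Suc k)"
    using p_ge_2 by (metis add_2_eq_Suc le_Suc_ex)
  have "card {a, b, c, d} \<le> 4" by (simp add: card_insert_if)
  then obtain B where B: "B \<in> [V - {a, b, c, d}]\<^bsup>k\<^esup>"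
    using ex_nsets_superset_avoiding[of V "{a, b, c, d}" "{}" k] finite_V card_V k by auto
  have "c \<notin> B" "d \<notin> B" "B \<in> [V - {a, b}]\<^bsup>k\<^esup>"
    using B by (auto simp: nsets_def)
  then have "insert c B \<in> [V - {a, b}]\<^bsup>Suc k\<^esup>" "insert d B \<in> [V - {a, b}]\<^bsup>Suc k\<^esup>"
    using assms by (simp_all add: insert_in_nsets)
  then have "sym_diff (biclique a b (insert c B)) (biclique a b (insert d B)) \<in> clique_span V p"
    unfolding k by (intro xor_closed_sym_diff xor_closed_clique_span biclique_in_clique_span assms)
  moreover have "sym_diff (insert c B) (insert d B) = sym_diff {c} {d}"
    using B by (auto simp: nsets_def)
  ultimately show ?thesis by (simp flip: xor_linearD[OF xor_linear_biclique])
qed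

lemma even_biclique_in_clique_span:
  assumes "a \<in> V" "b \<in> V" "A \<subseteq> V - {a, b}" "even (card A)"
  shows "biclique a b A \<in> clique_span V p"
proof -
  have "A \<in> biclique a b -` clique_span V p"
  proof (rule even_card_subset_in_xor_closed)
    show "finite A" using assms(3) finite_V finite_subset by blast
    show "xor_closed (biclique a b -` clique_span V p)"
      by (intro xor_closed_vimage xor_linear_biclique xor_closed_clique_span)
  next
    fix c d assume "c \<in> A" "d \<in> A"
    then have "c \<in> V - {a, b}" "d \<in> V - {a, b}" using assms(3) by auto
    then show "sym_diff {c} {d} \<in> biclique a b -` clique_span V p"
      unfolding vimage_def mem_Collect_eq by (rule four_cycle_in_clique_span[OF assms(1,2)])
  qed (rule assms(4))
  then show ?thesis by simp
qed

lemma path_in_clique_span: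
  assumes "even p" "a \<in> V" "b \<in> V" "c \<in> V - {a, b}"
  shows "biclique a b {c} \<in> clique_span V p"
proof -
  obtain k where k: "p = Suc k" "odd k"
    using p_ge_2 \<open>even p\<close> by (cases p) auto
  have "card {a, b} \<le> 2" by (simp add: card_insert_if)
  then obtain A where A: "A \<in> [V - {a, b}]\<^bsup>k\<^esup>" "c \<in> A"
    using ex_nsets_superset_avoiding[of V "{a, b}" "{c}" k] assms finite_V card_V k odd_pos by force
  then have "A - {c} \<subseteq> V - {a, b}" "even (card (A - {c}))"
    using k by (auto simp: nsets_def)
  then have "sym_diff (biclique a b A) (biclique a b (A - {c})) \<in> clique_span V p"
    using A assms unfolding k
    by (intro xor_closed_sym_diff xor_closed_clique_span biclique_in_clique_span
        even_biclique_in_clique_span[unfolded k])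
  moreover have "sym_diff A (A - {c}) = {c}" using A by auto
  ultimately show ?thesis by (simp flip: xor_linearD[OF xor_linear_biclique])
qed

lemma edges_congruent:
  assumes "even p" "e \<in> [V]\<^bsup>2\<^esup>" "f \<in> [V]\<^bsup>2\<^esup>"
  shows "sym_diff {e} {f} \<in> clique_span V p"
proof -
  have "sym_diff ([e]\<^bsup>2\<^esup>) ([f]\<^bsup>2\<^esup>) \<in> clique_span V p"
  proof (rule nsets_2_congruent_of_bicliques[OF xor_closed_clique_span, of V 1])
    fix a b A assume "a \<in> V" "b \<in> V" "A \<in> [V - {a, b}]\<^bsup>1\<^esup>"
    then show "biclique a b A \<in> clique_span V p"
      using path_in_clique_span[OF \<open>even p\<close>] by (auto simp: nsets_one)
  qed (use assms in \<open>simp_all add: numeral_2_eq_2\<close>)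
  then show ?thesis using assms(2,3) by (simp add: nsets_2_of_edge)
qed

lemma triangles_congruent:
  assumes "X \<in> [V]\<^bsup>3\<^esup>" "Y \<in> [V]\<^bsup>3\<^esup>"
  shows "sym_diff ([X]\<^bsup>2\<^esup>) ([Y]\<^bsup>2\<^esup>) \<in> clique_span V p"
proof (rule nsets_2_congruent_of_bicliques[OF xor_closed_clique_span, of V 2])
  fix a b A assume "a \<in> V" "b \<in> V" "A \<in> [V - {a, b}]\<^bsup>2\<^esup>"
  then show "biclique a b A \<in> clique_span V p"
    by (intro even_biclique_in_clique_span) (auto simp: nsets_def)
qed (use assms in simp_all)

lemma even_card_in_clique_span:
  assumes E: "E \<subseteq> [V]\<^bsup>2\<^esup>" "even (card E)" and degrees: "odd p \<Longrightarrow> even_degrees E"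
  shows "E \<in> clique_span V p"
proof (cases "even p")
  case True
  have "finite E" using finite_V E(1) by (rule finite_subset_nsets)
  then show ?thesis
  proof (rule even_card_subset_in_xor_closed[OF _ E(2) xor_closed_clique_span])
    fix e f assume "e \<in> E" "f \<in> E"
    then have "e \<in> [V]\<^bsup>2\<^esup>" "f \<in> [V]\<^bsup>2\<^esup>" using E(1) by auto
    then show "sym_diff {e} {f} \<in> clique_span V p" by (rule edges_congruent[OF True])
  qed
next
  case False
  show ?thesis
  proof (rule even_card_in_xor_closed[OF xor_closed_clique_span])
    show "E \<in> xor_span ((\<lambda>X. [X]\<^bsup>2\<^esup>) ` [V]\<^bsup>3\<^esup>)"
      using even_degrees_in_triangle_span[OF finite_V E(1) degrees[OF False]]
      unfolding clique_span_def .
  next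
    fix A B assume "A \<in> (\<lambda>X. [X]\<^bsup>2\<^esup>) ` [V]\<^bsup>3\<^esup>" "B \<in> (\<lambda>X. [X]\<^bsup>2\<^esup>) ` [V]\<^bsup>3\<^esup>"
    then obtain X Y where "X \<in> [V]\<^bsup>3\<^esup>" "Y \<in> [V]\<^bsup>3\<^esup>" "A = [X]\<^bsup>2\<^esup>" "B = [Y]\<^bsup>2\<^esup>" by blast
    then show "sym_diff A B \<in> clique_span V p" by (simp only: triangles_congruent)
  next
    fix A assume "A \<in> (\<lambda>X. [X]\<^bsup>2\<^esup>) ` [V]\<^bsup>3\<^esup>"
    then show "finite A \<and> odd (card A)"
      by (auto simp: nsets_def[of V] finite_imp_finite_nsets choose_two)
  qed (rule E(2))
qed

theorem in_clique_span_iff: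
  assumes E: "E \<subseteq> [V]\<^bsup>2\<^esup>"
  shows "E \<in> clique_span V p \<longleftrightarrow>
    (even (p choose 2) \<longrightarrow> even (card E)) \<and> (odd p \<longrightarrow> even_degrees E)"
proof
  assume parities: "(even (p choose 2) \<longrightarrow> even (card E)) \<and> (odd p \<longrightarrow> even_degrees E)"
  show "E \<in> clique_span V p"
  proof (cases "even (card E)")
    case True
    then show ?thesis using E parities even_card_in_clique_span by blast
  next
    case False
    obtain X where X: "X \<in> [V]\<^bsup>p\<^esup>"
      using ex_nsets_superset_avoiding[of V "{}" "{}" p] finite_V card_V by auto
    then have X': "X \<subseteq> V" "finite X" "card X = p" by (auto simp: nsets_def)
    have fin: "finite E" "finite ([X]\<^bsup>2\<^esup>)"
      using finite_subset_nsets[OF finite_V E] finite_imp_finite_nsets[OF X'(2)] by simp_all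
    have "sym_diff E ([X]\<^bsup>2\<^esup>) \<in> clique_span V p"
    proof (rule even_card_in_clique_span)
      show "sym_diff E ([X]\<^bsup>2\<^esup>) \<subseteq> [V]\<^bsup>2\<^esup>"
        using E nsets_mono[OF X'(1), of 2] by blast
      show "even (card (sym_diff E ([X]\<^bsup>2\<^esup>)))"
        using False parities X'(3) by (simp add: even_card_sym_diff fin)
      show "even_degrees (sym_diff E ([X]\<^bsup>2\<^esup>))" if "odd p"
        using that parities even_degrees_nsets_2[of X] X'(3)
        by (simp add: even_degrees_def even_degree_sym_diff fin)
    qed
    then have "sym_diff (sym_diff E ([X]\<^bsup>2\<^esup>)) ([X]\<^bsup>2\<^esup>) \<in> clique_span V p"
      by (rule xor_closed_sym_diff[OF xor_closed_clique_span _ clique_in_clique_span[OF X]])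
    also have "sym_diff (sym_diff E ([X]\<^bsup>2\<^esup>)) ([X]\<^bsup>2\<^esup>) = E" by blast
    finally show ?thesis .
  qed
qed (use clique_span_imp_even_card clique_span_imp_even_degrees in blast)

end

section \<open>Tournaments as edge sets\<close>

definition forward_edges :: "nat pair_pre_digraph \<Rightarrow> nat set set" where
  "forward_edges T = (\<lambda>(i, j). {i, j}) ` forward_arcs T"

lemma inj_on_forward_arcs: "inj_on (\<lambda>(i, j). {i, j}) (forward_arcs T)"
  by (auto simp: inj_on_def forward_arcs_def doubleton_eq_iff)

lemma card_forward_edges: "card (forward_edges T) = card (forward_arcs T)"
  unfolding forward_edges_def by (rule card_image[OF inj_on_forward_arcs])

lemma degree_forward_edges: "degree (forward_edges T) i = card (forward_arcs_at T i)"
proof -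
  have "{e \<in> forward_edges T. i \<in> e} = (\<lambda>(i, j). {i, j}) ` forward_arcs_at T i"
    by (auto simp: forward_edges_def forward_arcs_at_def)
  moreover have "inj_on (\<lambda>(i, j). {i, j}) (forward_arcs_at T i)"
    by (rule inj_on_subset[OF inj_on_forward_arcs]) (auto simp: forward_arcs_at_def)
  ultimately show ?thesis by (simp add: degree_def card_image)
qed

lemma in_forward_edges_iff: "i < j \<Longrightarrow> {i, j} \<in> forward_edges T \<longleftrightarrow> (i, j) \<in> parcs T"
  by (force simp: forward_edges_def forward_arcs_def doubleton_eq_iff)

lemma (in tournament) arc_reverse_iff:
  "\<lbrakk>u \<in> pverts G; v \<in> pverts G; u \<noteq> v\<rbrakk> \<Longrightarrow> (v, u) \<in> parcs G \<longleftrightarrow> (u, v) \<notin> parcs G"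
  using arc_between no_opposite_arcs by blast

lemma (in tournament) arc_vertsD:
  "(u, v) \<in> parcs G \<Longrightarrow> u \<in> pverts G \<and> v \<in> pverts G \<and> u \<noteq> v"
  using arc_fst_in_verts arc_snd_in_verts pair_no_loops by fastforce

lemma forward_edges_subset:
  assumes "tournament T"
  shows "forward_edges T \<subseteq> [pverts T]\<^bsup>2\<^esup>"
  using tournament.arc_vertsD[OF assms] by (auto simp: forward_edges_def forward_arcs_def)

lemma finite_forward_edges:
  assumes "tournament T"
  shows "finite (forward_edges T)"
proof -
  interpret tournament T by (rule assms)
  show ?thesis
    using pair_finite_verts forward_edges_subset[OF assms] by (rule finite_subset_nsets)
qed

lemma tournament_Inv:
  assumes "tournament T"
  shows "tournament (Inv T Xs)"
proof -
  interpret tournament T by (rule assms)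
  show ?thesis
  proof unfold_locales
    have "parcs (Inv T Xs) \<subseteq> pverts T \<times> pverts T"
      using arc_vertsD by (auto simp: in_parcs_Inv_iff split: if_splits)
    then show "finite (parcs (Inv T Xs))"
      using pair_finite_verts finite_subset by blast
  qed (use pair_finite_verts arc_vertsD no_opposite_arcs arc_between in
      \<open>fastforce simp: in_parcs_Inv_iff conj_commute split: if_splits\<close>)+
qed

lemma subset_nsets_2_eqI:
  fixes V :: "'a::linorder set"
  assumes "E \<subseteq> [V]\<^bsup>2\<^esup>" "F \<subseteq> [V]\<^bsup>2\<^esup>"
    and "\<And>i j. \<lbrakk>i \<in> V; j \<in> V; i < j\<rbrakk> \<Longrightarrow> {i, j} \<in> E \<longleftrightarrow> {i, j} \<in> F"
  shows "E = F"
  using assms unfolding ordered_nsets_2_eq by blast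

lemma tournament_eqI:
  assumes T: "tournament T" and T': "tournament T'" and verts: "pverts T = pverts T'"
    and edges: "forward_edges T = forward_edges T'"
  shows "T = T'"
proof -
  have forward: "(i, j) \<in> parcs T \<longleftrightarrow> (i, j) \<in> parcs T'" if "i < j" for i j
    using edges in_forward_edges_iff[OF that] by metis
  have "(u, v) \<in> parcs T \<longleftrightarrow> (u, v) \<in> parcs T'" for u v
  proof (cases "u \<in> pverts T \<and> v \<in> pverts T \<and> u \<noteq> v")
    case True
    then show ?thesis
      using forward tournament.arc_reverse_iff[OF T, of u v]
        tournament.arc_reverse_iff[OF T', of u v] verts
      by (cases u v rule: linorder_cases) auto
  next
    case False
    then show ?thesis
      using tournament.arc_vertsD[OF T] tournament.arc_vertsD[OF T'] verts by metis
  qed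
  then have "parcs T = parcs T'" by auto
  then show ?thesis using verts by simp
qed

lemma forward_edges_Inv:
  assumes T: "tournament T" and Xs: "\<forall>X\<in>set Xs. X \<subseteq> pverts T"
  shows "forward_edges (Inv T Xs) =
    sym_diff (forward_edges T) (xor_sum (map (\<lambda>X. [X]\<^bsup>2\<^esup>) Xs))"
proof (rule subset_nsets_2_eqI)
  show "forward_edges (Inv T Xs) \<subseteq> [pverts T]\<^bsup>2\<^esup>"
    using forward_edges_subset[OF tournament_Inv[OF T]] by simp
  have "[X]\<^bsup>2\<^esup> \<subseteq> [pverts T]\<^bsup>2\<^esup>" if "X \<in> set Xs" for X
    using that Xs by (intro nsets_mono) simp
  then have "xor_sum (map (\<lambda>X. [X]\<^bsup>2\<^esup>) Xs) \<in> Pow ([pverts T]\<^bsup>2\<^esup>)"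
    by (intro xor_closed_xor_sum) (auto simp: xor_closed_Pow)
  then show "sym_diff (forward_edges T) (xor_sum (map (\<lambda>X. [X]\<^bsup>2\<^esup>) Xs)) \<subseteq> [pverts T]\<^bsup>2\<^esup>"
    using forward_edges_subset[OF T] by auto
next
  fix i j assume ij: "i \<in> pverts T" "j \<in> pverts T" "i < j"
  then show "{i, j} \<in> forward_edges (Inv T Xs) \<longleftrightarrow>
      {i, j} \<in> sym_diff (forward_edges T) (xor_sum (map (\<lambda>X. [X]\<^bsup>2\<^esup>) Xs))"
    using tournament.arc_reverse_iff[OF T, of i j]
    by (auto simp: in_forward_edges_iff in_parcs_Inv_iff in_xor_sum_iff filter_map o_def)
qed

lemma Inv_iff_in_clique_span:
  assumes T1: "tournament T1" "pverts T1 = V" and T2: "tournament T2" "pverts T2 = V"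
  shows "(\<exists>Xs. (\<forall>X\<in>set Xs. X \<subseteq> V \<and> card X = p) \<and> T2 = Inv T1 Xs) \<longleftrightarrow>
    sym_diff (forward_edges T1) (forward_edges T2) \<in> clique_span V p"
proof -
  interpret tournament T1 by (rule T1)
  have nsets: "X \<subseteq> V \<and> card X = p \<longleftrightarrow> X \<in> [V]\<^bsup>p\<^esup>" for X
    using pair_finite_verts T1(2) by (auto simp: nsets_def dest: finite_subset)
  have "T2 = Inv T1 Xs \<longleftrightarrow>
      sym_diff (forward_edges T1) (forward_edges T2) = xor_sum (map (\<lambda>X. [X]\<^bsup>2\<^esup>) Xs)"
    if "Xs \<in> lists ([V]\<^bsup>p\<^esup>)" for Xs
  proof -
    have "T2 = Inv T1 Xs \<longleftrightarrow> forward_edges T2 = forward_edges (Inv T1 Xs)"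
      using tournament_eqI[OF T2(1) tournament_Inv[OF T1(1)], of Xs] T1(2) T2(2) by auto
    also have "forward_edges (Inv T1 Xs) =
        sym_diff (forward_edges T1) (xor_sum (map (\<lambda>X. [X]\<^bsup>2\<^esup>) Xs))"
      using that T1 by (intro forward_edges_Inv) (auto simp: nsets_def)
    finally show ?thesis by blast
  qed
  then show ?thesis
    unfolding nsets clique_span_def xor_span_def lists_image by (auto simp: image_image)
qed

lemma cong_2_iff_even: "[a = b] (mod 2) \<longleftrightarrow> (even a \<longleftrightarrow> even b)" for a b :: nat
  unfolding cong_def by presburger

lemma even_card_sym_diff_forward_edges:
  assumes "tournament T1" "tournament T2"
  shows "even (card (sym_diff (forward_edges T1) (forward_edges T2))) \<longleftrightarrow>
    [card (forward_arcs T1) = card (forward_arcs T2)] (mod 2)"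
  using assms
  by (simp add: even_card_sym_diff finite_forward_edges card_forward_edges cong_2_iff_even)

lemma even_degree_sym_diff_forward_edges:
  assumes "tournament T1" "tournament T2"
  shows "even (degree (sym_diff (forward_edges T1) (forward_edges T2)) i) \<longleftrightarrow>
    [card (forward_arcs_at T1 i) = card (forward_arcs_at T2 i)] (mod 2)"
  using assms
  by (simp add: even_degree_sym_diff finite_forward_edges degree_forward_edges cong_2_iff_even)

lemma even_choose_two: "even (n choose 2) \<longleftrightarrow> n mod 4 < 2"
proof (induction n)
  case 0
  then show ?case by (simp add: binomial_eq_0)
next
  case (Suc n)
  have "Suc n choose 2 = n + (n choose 2)"
    by (simp add: numeral_2_eq_2)
  then show ?case using Suc.IH by simp presburger
qed

theorem theorem1p1:
  fixes n p :: nat and T1 T2 :: "nat pair_pre_digraph"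
  assumes "p \<ge> 2" and "n \<ge> p + 2"
    and "tournament T1" and "pverts T1 = {1..n}"
    and "tournament T2" and "pverts T2 = {1..n}"
  shows "(\<exists>Xs :: nat set list.
            (\<forall>X \<in> set Xs. X \<subseteq> {1..n} \<and> card X = p) \<and> T2 = Inv T1 Xs) \<longleftrightarrow>
    ([p = 0] (mod 4) \<and> [card (forward_arcs T1) = card (forward_arcs T2)] (mod 2)) \<or>
    ([p = 1] (mod 4) \<and>
       (\<forall>i \<in> {1..n - 1}.
          [card (forward_arcs_at T1 i) = card (forward_arcs_at T2 i)] (mod 2)) \<and>
       [card (forward_arcs T1) = card (forward_arcs T2)] (mod 2)) \<or>
    [p = 2] (mod 4) \<or>
    ([p = 3] (mod 4) \<and>
       (\<forall>i \<in> {1..n - 1}.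
          [card (forward_arcs_at T1 i) = card (forward_arcs_at T2 i)] (mod 2)))"
    (is "?reachable \<longleftrightarrow> (_ \<and> ?size) \<or> (_ \<and> ?degrees \<and> _) \<or> _")
proof -
  define E where "E = sym_diff (forward_edges T1) (forward_edges T2)"
  have E: "E \<subseteq> [{1..n}]\<^bsup>2\<^esup>"
    using forward_edges_subset[OF assms(3)] forward_edges_subset[OF assms(5)] assms(4,6)
    unfolding E_def by auto
  have size: "even (card E) \<longleftrightarrow> ?size"
    unfolding E_def using assms by (intro even_card_sym_diff_forward_edges)
  have "{1..n} - {n} = {1..n - 1}" by auto
  then have degrees: "even_degrees E \<longleftrightarrow> ?degrees"
    using even_degrees_iff_all_but_one[OF _ E, of n] assms
    by (simp add: E_def even_degree_sym_diff_forward_edges)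
  have "?reachable \<longleftrightarrow> E \<in> clique_span {1..n} p"
    unfolding E_def using assms by (intro Inv_iff_in_clique_span)
  also have "\<dots> \<longleftrightarrow> (even (p choose 2) \<longrightarrow> even (card E)) \<and> (odd p \<longrightarrow> even_degrees E)"
    using assms E by (intro in_clique_span_iff) simp_all
  finally have iff: "?reachable \<longleftrightarrow> (even (p choose 2) \<longrightarrow> ?size) \<and> (odd p \<longrightarrow> ?degrees)"
    unfolding size degrees .
  have "p mod 4 < 4" by simp
  then consider "p mod 4 = 0" | "p mod 4 = 1" | "p mod 4 = 2" | "p mod 4 = 3" by linarith
  then show ?thesis
    unfolding iff even_choose_two even_even_mod_4_iff[of p] cong_def[of p]
    by cases (simp_all add: conj_commute)
qed

end
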